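(* Let $k \geq 2$ be an integer and let $G$ be a finite bipartite graph of order $n$ and girth $g$ with $|E(G)| \geq 4\left\lceil \frac{2(k-1)}{g-2} \right\rceil n^{1+1/k}$. Then $G$ contains a cycle of length $2k$.
   Context: The girth of $G$ is the length of a shortest cycle in $G$. *)

theory Defs
  imports Complex_Main "HOL-Library.Extended_Nat"
begin

definition fin_simple_graph :: "'a set \<Rightarrow> 'a set set \<Rightarrow> bool" where
  "fin_simple_graph V E \<longleftrightarrow> finite V \<and> (\<forall>e\<in>E. e \<subseteq> V \<and> card e = 2)"

definition bipartite :: "'a set \<Rightarrow> 'a set set \<Rightarrow> bool" where
  "bipartite V E \<longleftrightarrow>
     (\<exists>A B. A \<union> B = V \<and> A \<inter> B = {} \<and> (\<forall>e\<in>E. \<exists>a\<in>A. \<exists>b\<in>B. e = {a, b}))"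

(* A cycle is given by the list of its pairwise distinct vertices in cyclic order,
   without repeating the first one at the end; "length p" is then also the number
   of its edges.  Without the bound 3, a single edge would count as a 2-cycle. *)
definition is_cycle :: "'a set \<Rightarrow> 'a set set \<Rightarrow> 'a list \<Rightarrow> bool" where
  "is_cycle V E p \<longleftrightarrow>
     3 \<le> length p \<and> distinct p \<and> set p \<subseteq> V \<and>
     (\<forall>i<length p. {p ! i, p ! (Suc i mod length p)} \<in> E)"

(* Equal to infinity exactly when the graph has no cycle. *)
definition girth :: "'a set \<Rightarrow> 'a set set \<Rightarrow> enat" where
  "girth V E = (INF p\<in>{p. is_cycle V E p}. enat (length p))"

end

theory Submission imports Defs begin

text \<open>Let \<open>L\<close> be the ceiling. A subgraph of minimum degree at least \<open>4 * L * n powr (1 / k)\<close> cannot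
  expand by the factor \<open>n powr (1 / k)\<close> in each of the first \<open>k\<close> steps of a breadth-first search, so
  two consecutive layers \<open>i\<close>, \<open>i + 1\<close> with \<open>i < k\<close> span a bipartite graph with at least \<open>L\<close> times as
  many edges as vertices. A subgraph of it has minimum degree above \<open>L\<close>, and a longest path there
  yields a cycle of length at least \<open>L * (g - 2) + 2 \<ge> 2 * k\<close>, with a chord if \<open>L \<ge> 2\<close>. Let \<open>h\<close> be the
  height above layer \<open>i\<close> at which the tree paths from the vertices of this cycle in layer \<open>i\<close> have
  all merged; the last merging splits these vertices into classes. A cycle with a chord contains
  paths of all even lengths between different classes; one of length \<open>2 * k - 2 * h\<close> together with two
  tree paths of length \<open>h\<close> is the required cycle. If \<open>L = 1\<close>, then \<open>g \<ge> 2 * k\<close>, and the same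
  construction with a path of length \<open>2\<close> gives a cycle of length at most \<open>2 * k\<close>.\<close>

subsection \<open>Paths in a cycle with a chord\<close>

lemma periodic_mult:
  fixes f :: "int \<Rightarrow> 'b" and p u :: int
  assumes "\<And>j. f (j + p) = f j"
  shows "f (j + u * p) = f j"
proof (induction u rule: int_induct[of _ 0])
  case (step1 i)
  then show ?case using assms[of "j + i * p"] by (simp add: algebra_simps)
next
  case (step2 i)
  then show ?case using assms[of "j + (i - 1) * p"] by (simp add: algebra_simps)
qed simp

text \<open>Bezout: the periods of a function form a subgroup of the integers.\<close>

lemma periodic_gcd:
  fixes f :: "int \<Rightarrow> 'b" and p q :: int
  assumes "\<And>j. f (j + p) = f j" "\<And>j. f (j + q) = f j"
  shows "f (j + gcd p q) = f j"
proof -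
  obtain u v where "u * p + v * q = gcd p q" using bezout_int by blast
  then have "f (j + gcd p q) = f ((j + u * p) + v * q)" by (simp add: algebra_simps)
  then show ?thesis
    using periodic_mult[of f p, OF assms(1)] periodic_mult[of f q, OF assms(2)] by simp
qed

lemma periodic_all:
  fixes Q :: "int \<Rightarrow> bool" and p a :: int
  assumes "p > 0" "\<And>j. Q (j + p) = Q j" "\<And>j. a \<le> j \<Longrightarrow> j < a + p \<Longrightarrow> Q j"
  shows "Q j"
proof -
  define i where "i = a + (j - a) mod p"
  have "Q i" using assms(1,3) by (simp add: i_def)
  moreover have "j = i + ((j - a) div p) * p"
    using div_mult_mod_eq[of "j - a" p] by (simp add: i_def algebra_simps)
  ultimately show ?thesis using periodic_mult[of Q p, OF assms(2)] by metis
qed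

lemma periodic_one_const:
  fixes f :: "int \<Rightarrow> 'b"
  assumes "\<And>j. f (j + 1) = f j"
  shows "f i = f j"
  using periodic_mult[of f 1 j "i - j"] assms by simp

text \<open>The hypotheses encode the four ways in which a path of length \<open>2 * m\<close> can run through the chord
  joining \<open>0\<close> and \<open>2 * R + 1\<close> of a cycle of length \<open>2 * M\<close>; \<open>f j\<close> is the colour of vertex \<open>2 * j\<close>.\<close>

lemma reflections_const_short:
  fixes f :: "int \<Rightarrow> 'b" and M m R :: int
  assumes m: "0 < m" "m < M" and R: "1 \<le> R" "R \<le> M - 2"
    and perM: "\<And>j. f (j + M) = f j" and perm: "\<And>j. f (j + m) = f j"
    and shift: "\<And>j. 0 \<le> j \<Longrightarrow> j < m \<Longrightarrow> f (-j) = f (R + m - j)"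
    and refl1: "\<And>j. 0 \<le> j \<Longrightarrow> j < m \<Longrightarrow> j < M - R \<Longrightarrow> m - R \<le> j \<Longrightarrow> f (-j) = f (R + 1 - m + j)"
    and refl2: "\<And>j. 0 \<le> j \<Longrightarrow> j < m \<Longrightarrow> j \<le> R \<Longrightarrow> m - M + R < j \<Longrightarrow> f j = f (R + m - j)"
    and short: "m < M - R"
  shows "f i = f j"
proof -
  \<comment> \<open>\<open>shift\<close> covers \<open>m\<close> consecutive values and
    \<open>m\<close> is a period, so the equation holds for every integer and makes \<open>R\<close>
    a period.\<close>
  have perR: "f (j + R) = f j" for j
  proof -
    have "f (R - j) = f (-j)" for j
    proof (rule periodic_all[of m "\<lambda>j. f (R - j) = f (-j)" 0])
      fix j
      show "(f (R - (j + m)) = f (-(j + m))) = (f (R - j) = f (-j))"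
        using perm[of "R - (j + m)"] perm[of "-(j + m)"] by (simp add: algebra_simps)
    next
      fix j assume "0 \<le> j" "j < 0 + m"
      then show "f (R - j) = f (-j)"
        using shift[of j] perm[of "R - j"] by (simp add: algebra_simps)
    qed (use m in simp)
    from this[of "-j"] show ?thesis by (simp add: algebra_simps)
  qed
  define p where "p = gcd (gcd m M) R"
  have per: "f (j + p) = f j" for j
    unfolding p_def by (intro periodic_gcd perm perM perR)
  have p: "p > 0" using m by (simp add: p_def)
  have dvd: "p dvd m" "p dvd M" "p dvd R" by (auto simp: p_def intro: dvd_trans)
  have le: "p \<le> R" "p \<le> m" "p \<le> M - m"
    using dvd m R by (auto intro: zdvd_imp_le)
  have perneg: "f (j - p) = f j" for j using per[of "j - p"] by simp
  \<comment> \<open>The windows in which \<open>refl1\<close> and \<open>refl2\<close> apply contain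
    at least \<open>p\<close> consecutive values of \<open>j\<close>, so both reflections extend to
    all integers. Composed, they are the translation by 1.\<close>
  have 1: "f (-j) = f (1 + j)" for j
  proof -
    have *: "f (-j) = f (R + 1 - m + j)" for j
    proof (rule periodic_all[of p "\<lambda>j. f (-j) = f (R + 1 - m + j)" "max 0 (m - R)"])
      fix j show "(f (-(j + p)) = f (R + 1 - m + (j + p))) = (f (-j) = f (R + 1 - m + j))"
        using perneg[of "-j"] per[of "R + 1 - m + j"] by (simp add: algebra_simps)
    qed (use p le short in \<open>auto intro!: refl1\<close>)
    have "f (R + 1 - m + j) = f (1 + j)"
      using perR[of "1 - m + j"] perm[of "1 - m + j"] by (simp add: algebra_simps)
    with * show ?thesis by simp
  qed
  have 2: "f j = f (-j)" for j
  proof -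
    have *: "f j = f (R + m - j)" for j
    proof (rule periodic_all[of p "\<lambda>j. f j = f (R + m - j)" 0])
      fix j show "(f (j + p) = f (R + m - (j + p))) = (f j = f (R + m - j))"
        using per[of j] perneg[of "R + m - j"] by (simp add: algebra_simps)
    qed (use p le short in \<open>auto intro!: refl2\<close>)
    have "f (R + m - j) = f (-j)"
      using perR[of "m - j"] perm[of "-j"] by (simp add: algebra_simps)
    with * show ?thesis by simp
  qed
  show ?thesis by (rule periodic_one_const) (metis 1 2 add.commute)
qed

text \<open>Reading the cycle backwards exchanges the two arcs cut off by the chord, so a path
  length admitting either shift reduces to the previous lemma. If neither shift is available, the
  two reflections alone suffice.\<close>

lemma reflections_const:
  fixes f :: "int \<Rightarrow> 'b" and M m R :: int
  assumes m: "0 < m" "m < M" and R: "1 \<le> R" "R \<le> M - 2"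
    and perM: "\<And>j. f (j + M) = f j" and perm: "\<And>j. f (j + m) = f j"
    and shift1: "\<And>j. 0 \<le> j \<Longrightarrow> j < m \<Longrightarrow> m < M - R \<Longrightarrow> f (-j) = f (R + m - j)"
    and refl1: "\<And>j. 0 \<le> j \<Longrightarrow> j < m \<Longrightarrow> j < M - R \<Longrightarrow> m - R \<le> j \<Longrightarrow> f (-j) = f (R + 1 - m + j)"
    and refl2: "\<And>j. 0 \<le> j \<Longrightarrow> j < m \<Longrightarrow> j \<le> R \<Longrightarrow> m - M + R < j \<Longrightarrow> f j = f (R + m - j)"
    and shift2: "\<And>j. 0 \<le> j \<Longrightarrow> j < m \<Longrightarrow> m \<le> R \<Longrightarrow> f j = f (R + 1 - m + j)"
  shows "f i = f j"
proof -
  consider "m < M - R" | "m \<le> R" | "m \<ge> M - R" "m > R" by linarith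
  then show ?thesis
  proof cases
    case 1
    show ?thesis
      by (rule reflections_const_short[of m M R]) (use assms 1 in auto)
  next
    case 2
    \<comment> \<open>The substitution \<open>j\<close> to \<open>-j\<close> turns \<open>R\<close>
      into \<open>M - 1 - R\<close> and exchanges the two shifts as well as the two
      reflections.\<close>
    have neg: "f (- (M - 1 - R + 1 - m + j)) = f (R + m - j)"
      "f (- (M - 1 - R + m - j)) = f (R + 1 - m + j)" for j
      using perM[of "R + m - j - M"] perM[of "R + 1 - m + j - M"] by (simp_all add: algebra_simps)
    have "f (- (- i)) = f (- (- j))"
    proof (rule reflections_const_short[of m M "M - 1 - R" "\<lambda>j. f (-j)"])
      fix j :: int
      show "f (-(j + M)) = f (-j)" using perM[of "-(j + M)"] by (simp add: algebra_simps)
      show "f (-(j + m)) = f (-j)" using perm[of "-(j + m)"] by (simp add: algebra_simps)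
    qed (use m R 2 neg shift2 refl1 refl2 in \<open>auto simp del: minus_add_distrib minus_diff_eq\<close>)
    then show ?thesis by simp
  next
    case 3
    \<comment> \<open>Both reflection windows now have length \<open>M - m\<close>, a positive
      multiple of \<open>p\<close>; the two reflections again compose to the translation by
      1.\<close>
    define p where "p = gcd m M"
    have per: "f (j + p) = f j" for j
      unfolding p_def by (intro periodic_gcd perm perM)
    have p: "p > 0" using m by (simp add: p_def)
    have dvd: "p dvd m" "p dvd M" by (auto simp: p_def)
    have le: "p \<le> M - m" using dvd m by (auto intro: zdvd_imp_le)
    have perneg: "f (j - p) = f j" for j using per[of "j - p"] by simp
    have 1: "f (-j) = f (R + 1 + j)" for j
    proof -
      have "f (-j) = f (R + 1 - m + j)" for j
      proof (rule periodic_all[of p "\<lambda>j. f (-j) = f (R + 1 - m + j)" "m - R"])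
        fix j show "(f (-(j + p)) = f (R + 1 - m + (j + p))) = (f (-j) = f (R + 1 - m + j))"
          using perneg[of "-j"] per[of "R + 1 - m + j"] by (simp add: algebra_simps)
      qed (use p le 3 in \<open>auto intro!: refl1\<close>)
      then show ?thesis using perm[of "R + 1 - m + j"] by (simp add: algebra_simps)
    qed
    have 2: "f j = f (R - j)" for j
    proof -
      have "f j = f (R + m - j)" for j
      proof (rule periodic_all[of p "\<lambda>j. f j = f (R + m - j)" "m - M + R + 1"])
        fix j show "(f (j + p) = f (R + m - (j + p))) = (f j = f (R + m - j))"
          using per[of j] perneg[of "R + m - j"] by (simp add: algebra_simps)
      qed (use p le 3 R in \<open>auto intro!: refl2\<close>)
      then show ?thesis using perm[of "R - j"] by (simp add: algebra_simps)
    qed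
    have "f (j + 1) = f j" for j
      using 1[of "j - R"] 2[of "R - j"] by (simp add: algebra_simps)
    then show ?thesis by (rule periodic_one_const)
  qed
qed

section \<open>Paths along an unrolled cycle\<close>

lemma successively_upto:
  assumes "\<And>j. a \<le> j \<Longrightarrow> j < b \<Longrightarrow> P j (j + 1)"
  shows "successively P [a..b]"
  unfolding successively_conv_nth
proof (intro allI impI)
  fix i assume "Suc i < length [a..b]"
  then have "a + int (Suc i) \<le> b" by simp
  then show "P ([a..b] ! i) ([a..b] ! Suc i)"
    using assms[of "a + int i"] by (simp add: algebra_simps)
qed

text \<open>The map \<open>c\<close> unrolls a cycle of length \<open>2 * M\<close> over the
  integers. If every path of length \<open>2 * m\<close> between vertices of \<open>X\<close> had
  ends of equal colour \<open>P\<close>, each way of placing such a path, along the cycle or through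
  the chord, would give an identity between colours at even indices, and together these identities
  make the colour constant.\<close>

lemma theta_path:
  fixes c :: "int \<Rightarrow> 'a" and M m R :: int
  assumes c: "\<And>i j. c i = c j \<longleftrightarrow> 2 * M dvd i - j"
    and step: "\<And>j. {c j, c (j + 1)} \<in> F"
    and X: "\<And>j. c j \<in> X \<longleftrightarrow> even j"
    and m: "0 < m" "m < M"
    and chord: "m = 1 \<or> 1 \<le> R \<and> R \<le> M - 2 \<and> {c 0, c (2 * R + 1)} \<in> F"
    and P: "P (c (2 * i)) \<noteq> P (c (2 * j))"
  shows "\<exists>q. distinct q \<and> successively (\<lambda>x y. {x, y} \<in> F) q \<and> set q \<subseteq> range c
           \<and> length q = nat (2 * m + 1) \<and> hd q \<in> X \<and> last q \<in> X \<and> P (hd q) \<noteq> P (last q)"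
proof (rule ccontr)
  assume no: "\<not> ?thesis"
  let ?adj = "\<lambda>i j. {c i, c j} \<in> F"
  have step': "?adj (j + 1) j" for j using step[of j] by (simp add: insert_commute)
  \<comment> \<open>An index window of extent below \<open>2 * M\<close> meets no vertex twice, so a
    repetition-free walk of indices inside it is a path.\<close>
  have same: "P (c (hd js)) = P (c (last js))"
    if "distinct js" "set js \<subseteq> {a..b}" "b - a < 2 * M" "successively ?adj js"
      "length js = nat (2 * m + 1)" "even (hd js)" "even (last js)" for js a b
  proof -
    have "inj_on c (set js)"
    proof (rule inj_onI)
      fix x y assume xy: "x \<in> set js" "y \<in> set js" "c x = c y"
      then have "2 * M dvd x - y" using c by simp
      moreover have "a \<le> x" "x \<le> b" "a \<le> y" "y \<le> b" using xy that(2) by auto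
      then have "\<bar>x - y\<bar> < 2 * M" using that(3) by linarith
      ultimately show "x = y" using dvd_imp_le_int[of "x - y" "2 * M"] by fastforce
    qed
    moreover have "js \<noteq> []" using that(5) m by auto
    ultimately show ?thesis
      using no that X by (auto simp: distinct_map successively_map hd_map last_map
          dest!: spec[of _ "map c js"])
  qed
  have up: "successively ?adj [a..b]" for a b by (rule successively_upto) (rule step)
  have down: "successively ?adj (rev [a..b])" for a b
    unfolding successively_rev by (rule successively_upto) (rule step')
  have hdup: "hd [a..b] = a" "last [a..b] = b" if "a \<le> b" for a b :: int
    using that by (simp add: upto.simps, simp add: upto_rec2)
  define f where "f j = P (c (2 * j))" for j
  have perm: "f (j + m) = f j" for j
    using same[of "[2 * j..2 * j + 2 * m]" "2 * j" "2 * j + 2 * m"] m up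
    by (simp add: hdup f_def algebra_simps)
  have "f i = f j"
  proof (cases "m = 1")
    case True
    then show ?thesis using periodic_one_const[of f] perm by simp
  next
    case False
    then have R: "1 \<le> R" "R \<le> M - 2" and ch: "{c 0, c (2 * R + 1)} \<in> F" using chord by auto
    show ?thesis
    proof (rule reflections_const[of m M R])
      fix j :: int
      have "c (2 * (j + M)) = c (2 * j)" unfolding c by (simp add: algebra_simps)
      then show "f (j + M) = f j" by (simp add: f_def)
      assume j: "0 \<le> j" "j < m"
      \<comment> \<open>The path runs along \<open>2 * j\<close> edges to index 0, through the chord
        to \<open>?r\<close>, and along the remaining \<open>?t\<close> edges. The four cases are
        the directions of the two arcs; the side conditions keep the arcs disjoint and the window
        short.\<close>
      let ?r = "2 * R + 1" and ?t = "2 * m - 1 - 2 * j"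
      show "f (-j) = f (R + m - j)" if "m < M - R"
        using same[of "[-(2 * j)..0] @ [?r..?r + ?t]" "-(2 * j)" "?r + ?t"] that j m R up ch
        by (auto simp: hdup f_def successively_append_iff algebra_simps)
      show "f (-j) = f (R + 1 - m + j)" if "j < M - R" "m - R \<le> j"
        using same[of "[-(2 * j)..0] @ rev [?r - ?t..?r]" "-(2 * j)" ?r] that j m R up down ch
        by (auto simp: hdup f_def successively_append_iff hd_rev last_rev algebra_simps)
      show "f j = f (R + m - j)" if "j \<le> R" "m - M + R < j"
        using same[of "rev [0..2 * j] @ [?r..?r + ?t]" 0 "?r + ?t"] that j m R up down ch
        by (auto simp: hdup f_def successively_append_iff hd_rev last_rev algebra_simps)
      show "f j = f (R + 1 - m + j)" if "m \<le> R"
        using same[of "rev [0..2 * j] @ rev [?r - ?t..?r]" 0 ?r] that j m R down ch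
        by (auto simp: hdup f_def successively_append_iff hd_rev last_rev algebra_simps)
    qed (use m R perm in auto)
  qed
  with P show False by (simp add: f_def)
qed

section \<open>Cycles as vertex lists\<close>

lemma is_cycleI:
  assumes "3 \<le> length p" "distinct p" "set p \<subseteq> V" "successively (\<lambda>x y. {x, y} \<in> E) p"
    "{last p, hd p} \<in> E"
  shows "is_cycle V E p"
  unfolding is_cycle_def
proof (intro conjI allI impI)
  fix i assume i: "i < length p"
  show "{p ! i, p ! (Suc i mod length p)} \<in> E"
  proof (cases "Suc i < length p")
    case True
    then show ?thesis using assms(4) by (simp add: successively_conv_nth)
  next
    case False
    with i have "Suc i mod length p = 0" "i = length p - 1" by (simp_all add: not_less_eq less_Suc_eq)
    moreover have "p \<noteq> []" using i by auto
    ultimately show ?thesis using assms(5) by (simp add: last_conv_nth hd_conv_nth)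
  qed
qed (use assms in auto)

lemma is_cycle_mono:
  "is_cycle U F p \<Longrightarrow> U \<subseteq> V \<Longrightarrow> F \<subseteq> E \<Longrightarrow> is_cycle V E p"
  unfolding is_cycle_def by blast

text \<open>The sides alternate around the cycle, which excludes length 3 and leaves at least two
  vertices on each side.\<close>

lemma cycle_two_on_side:
  assumes "is_cycle U F p" and sides: "\<And>x y. {x, y} \<in> F \<Longrightarrow> x \<in> X \<longleftrightarrow> y \<notin> X"
  shows "\<exists>a b. a \<in> set p \<inter> X \<and> b \<in> set p \<inter> X \<and> a \<noteq> b"
proof -
  have len: "3 \<le> length p" and d: "distinct p"
    and e: "\<And>i. i < length p \<Longrightarrow> {p ! i, p ! (Suc i mod length p)} \<in> F"
    using assms(1) by (auto simp: is_cycle_def)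
  have "p \<noteq> []" using len by auto
  have 0: "p ! 0 \<in> X \<longleftrightarrow> p ! 1 \<notin> X" and 1: "p ! 1 \<in> X \<longleftrightarrow> p ! 2 \<notin> X"
    using sides[of "p ! 0" "p ! 1"] sides[of "p ! 1" "p ! 2"] e[of 0] e[of 1] len \<open>p \<noteq> []\<close>
    by (auto simp: numeral_2_eq_2)
  have 2: "p ! 2 \<in> X \<longleftrightarrow> p ! (3 mod length p) \<notin> X"
    using e[of 2] len sides by (auto simp: numeral_3_eq_3 numeral_2_eq_2)
  show ?thesis
  proof (cases "p ! 0 \<in> X")
    case True
    then show ?thesis using 0 1 len d \<open>p \<noteq> []\<close>
      by (intro exI[of _ "p ! 0"] exI[of _ "p ! 2"]) (auto simp: nth_eq_iff_index_eq)
  next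
    case False
    have "length p \<noteq> 3" using False 0 1 2 by auto
    then have "3 < length p" using len by simp
    then show ?thesis using False 0 1 2 d
      by (intro exI[of _ "p ! 1"] exI[of _ "p ! 3"]) (auto simp: nth_eq_iff_index_eq)
  qed
qed

text \<open>Transfers the result on unrolled cycles to vertex lists, after moving the origin to a
  vertex of \<open>X\<close>.\<close>

lemma cycle_theta_path:
  fixes p :: "'a list"
  assumes cyc: "is_cycle U F p" and sides: "\<And>x y. {x, y} \<in> F \<Longrightarrow> x \<in> X \<longleftrightarrow> y \<notin> X"
    and m: "0 < m" "2 * m < length p"
    and chord: "m = 1 \<or> (\<exists>r\<ge>2. r + 2 \<le> length p \<and> {p ! 0, p ! r} \<in> F)"
    and ab: "a \<in> set p" "a \<in> X" "b \<in> set p" "b \<in> X" "P a \<noteq> P b"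
  shows "\<exists>q. distinct q \<and> successively (\<lambda>x y. {x, y} \<in> F) q \<and> set q \<subseteq> set p
           \<and> length q = 2 * m + 1 \<and> hd q \<in> X \<and> last q \<in> X \<and> P (hd q) \<noteq> P (last q)"
proof -
  define N where "N = int (length p)"
  have len: "3 \<le> length p" and d: "distinct p"
    and e: "\<And>i. i < length p \<Longrightarrow> {p ! i, p ! (Suc i mod length p)} \<in> F"
    using cyc by (auto simp: is_cycle_def)
  have N: "N \<ge> 3" using len by (simp add: N_def)
  define c0 where "c0 j = p ! nat (j mod N)" for j
  have lt: "nat (j mod N) < length p" for j
    using pos_mod_bound[of N j] pos_mod_sign[of N j] N unfolding N_def by linarith
  have c0: "c0 i = c0 j \<longleftrightarrow> N dvd i - j" for i j
  proof -
    have "c0 i = c0 j \<longleftrightarrow> nat (i mod N) = nat (j mod N)"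
      unfolding c0_def using d lt by (simp add: nth_eq_iff_index_eq)
    also have "\<dots> \<longleftrightarrow> i mod N = j mod N" using N by (simp add: eq_nat_nat_iff)
    finally show ?thesis by (simp add: mod_eq_dvd_iff)
  qed
  have step0: "{c0 j, c0 (j + 1)} \<in> F" for j
  proof -
    have "int (Suc (nat (j mod N)) mod length p) = (j + 1) mod N"
      using N by (simp add: zmod_int mod_simps add.commute flip: N_def)
    then have "nat ((j + 1) mod N) = Suc (nat (j mod N)) mod length p" by linarith
    then show ?thesis using e[OF lt] by (simp add: c0_def)
  qed
  have c0_nat: "c0 (int i) = p ! i" if "i < length p" for i
    using that by (simp add: c0_def N_def)
  \<comment> \<open>If \<open>p ! 0\<close> is not in \<open>X\<close>, the other end of the chord
    is; seen from there the chord spans the complementary distance \<open>N - r\<close>. For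
    \<open>m = 1\<close> any vertex of \<open>X\<close> serves as origin.\<close>
  obtain s r' where s: "c0 s \<in> X"
    and r': "m = 1 \<or> 2 \<le> r' \<and> r' \<le> N - 2 \<and> {c0 s, c0 (s + r')} \<in> F"
  proof (cases "m = 1")
    case True
    have "c0 0 \<in> X \<or> c0 1 \<in> X" using step0[of 0] sides by force
    then show ?thesis using that True by blast
  next
    case False
    then obtain r where r: "r \<ge> 2" "r + 2 \<le> length p" "{p ! 0, p ! r} \<in> F" using chord by blast
    moreover have "0 < length p" using len by linarith
    ultimately have F: "{c0 0, c0 (int r)} \<in> F" using c0_nat[of 0] c0_nat[of r] by simp
    show ?thesis
    proof (cases "c0 0 \<in> X")
      case True
      then show ?thesis using that[of 0 "int r"] r F by (simp add: N_def)
    next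
      case False
      moreover have "c0 N = c0 0" by (simp add: c0)
      ultimately show ?thesis using that[of "int r" "N - int r"] r F sides[OF F]
        by (simp add: N_def insert_commute)
    qed
  qed
  define c where "c j = c0 (s + j)" for j
  have c: "c i = c j \<longleftrightarrow> N dvd i - j" for i j by (simp add: c_def c0)
  have step: "{c j, c (j + 1)} \<in> F" for j using step0[of "s + j"] by (simp add: c_def add.assoc)
  have X: "c j \<in> X \<longleftrightarrow> even j" for j
  proof (induction j rule: int_induct[of _ 0])
    case base
    then show ?case using s by (simp add: c_def)
  next
    case (step1 i)
    then show ?case using sides[OF step[of i]] by auto
  next
    case (step2 i)
    then show ?case using sides[OF step[of "i - 1"]] by auto
  qed
  \<comment> \<open>Membership in \<open>X\<close> alternates with the index, so returning to the
    origin after \<open>N\<close> steps forces \<open>N\<close> to be even.\<close>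
  have "c N = c 0" by (simp add: c)
  then have "even N" using X by (metis even_zero)
  then obtain M where M: "N = 2 * M" by blast
  have mem: "\<exists>i. x = c (2 * i)" if x: "x \<in> set p" "x \<in> X" for x
  proof -
    obtain i where "i < length p" "x = p ! i" using x by (auto simp: in_set_conv_nth)
    then have "x = c (int i - s)" using c0_nat by (simp add: c_def)
    then show ?thesis using x X by (metis evenE)
  qed
  obtain i j where ij: "a = c (2 * i)" "b = c (2 * j)" using mem ab by metis
  define R where "R = r' div 2"
  have chord': "int m = 1 \<or> 1 \<le> R \<and> R \<le> M - 2 \<and> {c 0, c (2 * R + 1)} \<in> F"
  proof (cases "m = 1")
    case False
    then have r: "2 \<le> r'" "r' \<le> N - 2" "{c 0, c r'} \<in> F" using r' by (auto simp: c_def)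
    then have "odd r'" using sides X by (metis even_zero)
    then have "r' = 2 * R + 1" by (simp add: R_def)
    then show ?thesis using r M by auto
  qed simp
  have "\<exists>q. distinct q \<and> successively (\<lambda>x y. {x, y} \<in> F) q \<and> set q \<subseteq> range c
           \<and> length q = nat (2 * int m + 1) \<and> hd q \<in> X \<and> last q \<in> X \<and> P (hd q) \<noteq> P (last q)"
    by (rule theta_path[of c M F X "int m" R P i j])
      (use c step X M m chord' ab ij in \<open>auto simp: N_def\<close>)
  moreover have "range c \<subseteq> set p"
    using lt by (auto simp: c_def c0_def)
  ultimately show ?thesis by (force simp: nat_add_distrib nat_mult_distrib)
qed

subsection \<open>Subgraphs of large minimum degree\<close>

text \<open>Deleting a vertex of degree at most \<open>D\<close> loses at most \<open>D\<close>
  edges, so the bound on edges against vertices survives. The deletions stop before the last vertex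
  is removed, because a single vertex spans no edge.\<close>

lemma dense_subgraph:
  fixes D :: real
  assumes G: "fin_simple_graph V E" and "V \<noteq> {}" and D: "D > 0" and "card E \<ge> D * card V"
  shows "\<exists>W\<subseteq>V. W \<noteq> {} \<and> (\<forall>v\<in>W. D < card {e\<in>E. e \<subseteq> W \<and> v \<in> e})"
proof -
  have "finite V" "E \<subseteq> Pow V" using G by (auto simp: fin_simple_graph_def)
  then have finE: "finite E" by (simp add: finite_subset)
  have shrink: "finite W \<Longrightarrow> W \<noteq> {} \<Longrightarrow> card {e\<in>E. e \<subseteq> W} \<ge> D * card W \<Longrightarrow> ?thesis" if "W \<subseteq> V" for W
    using that
  proof (induction "card W" arbitrary: W rule: less_induct)
    case less
    show ?case
    proof (cases "\<forall>v\<in>W. D < card {e\<in>E. e \<subseteq> W \<and> v \<in> e}")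
      case False
      then obtain v where v: "v \<in> W" "card {e\<in>E. e \<subseteq> W \<and> v \<in> e} \<le> D" by force
      define W' where "W' = W - {v}"
      have "{e\<in>E. e \<subseteq> W} = {e\<in>E. e \<subseteq> W'} \<union> {e\<in>E. e \<subseteq> W \<and> v \<in> e}" by (auto simp: W'_def)
      then have "card {e\<in>E. e \<subseteq> W} \<le> card {e\<in>E. e \<subseteq> W'} + card {e\<in>E. e \<subseteq> W \<and> v \<in> e}"
        by (simp add: card_Un_le)
      then have "card {e\<in>E. e \<subseteq> W'} \<ge> D * card W - D" using less.prems(3) v(2) by linarith
      moreover have cW: "card W = Suc (card W')"
        using v(1) less.prems(1) unfolding W'_def by (metis card.remove)
      ultimately have *: "card {e\<in>E. e \<subseteq> W'} \<ge> D * card W'" by (simp add: algebra_simps)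
      have "W' \<noteq> {}"
      proof
        assume "W' = {}"
        then have "W = {v}" using v(1) by (auto simp: W'_def)
        then have emp: "{e\<in>E. e \<subseteq> W} = {}"
          using G by (auto simp: fin_simple_graph_def subset_singleton_iff)
        have "D * card W \<le> 0" using less.prems(3) unfolding emp by simp
        then show False using D \<open>W = {v}\<close> by simp
      qed
      then show ?thesis using less.hyps[of W'] less.prems * cW by (auto simp: W'_def)
    qed (use less.prems in blast)
  qed
  have "{e\<in>E. e \<subseteq> V} = E" using \<open>E \<subseteq> Pow V\<close> by blast
  then show ?thesis by (intro shrink[of V]) (use assms \<open>finite V\<close> in auto)
qed

text \<open>The end of a longest path has all its neighbours on that path, at mutual distance at least
  \<open>g - 2\<close>; the farthest one closes the cycle.\<close>

lemma long_cycle_chord: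
  assumes G: "fin_simple_graph U F" and "U \<noteq> {}" and deg: "\<And>v. v \<in> U \<Longrightarrow> d \<le> card {e\<in>F. v \<in> e}"
    and d: "d \<ge> 2" and g: "\<And>p. is_cycle U F p \<Longrightarrow> g \<le> length p" "g \<ge> 3"
  shows "\<exists>p. is_cycle U F p \<and> (d - 1) * (g - 2) + 2 \<le> length p
           \<and> (d \<ge> 3 \<longrightarrow> (\<exists>r\<ge>2. r + 2 \<le> length p \<and> {p ! 0, p ! r} \<in> F))"
proof -
  have finU: "finite U" and F: "\<And>e. e \<in> F \<Longrightarrow> e \<subseteq> U \<and> card e = 2"
    using G by (auto simp: fin_simple_graph_def)
  let ?path = "\<lambda>q. q \<noteq> [] \<and> distinct q \<and> set q \<subseteq> U \<and> successively (\<lambda>x y. {x, y} \<in> F) q"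
  have bound: "length q < Suc (card U)" if "?path q" for q
    using that finU card_mono distinct_card by (metis less_Suc_eq_le)
  obtain v where "v \<in> U" using \<open>U \<noteq> {}\<close> by blast
  then have "?path [v]" by simp
  with bound obtain q where q: "?path q" and max: "\<And>q'. ?path q' \<Longrightarrow> length q' \<le> length q"
    using ex_has_greatest_nat[of ?path "[v]" length "Suc (card U)"] by blast
  define x where "x = q ! 0"
  have x: "x = hd q" "x \<in> U" using q by (auto simp: x_def hd_conv_nth)
  define I where "I = {j. j < length q \<and> {x, q ! j} \<in> F}"
  have finI: "finite I" by (simp add: I_def)
  have I0: "j \<noteq> 0" if "j \<in> I" for j
    using that F[of "{x, q ! j}"] by (auto simp: I_def x_def intro: ccontr)
  have "{e\<in>F. x \<in> e} \<subseteq> (\<lambda>j. {x, q ! j}) ` I"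
  proof
    fix e assume e: "e \<in> {e\<in>F. x \<in> e}"
    then obtain w where w: "e = {x, w}" "w \<in> U" "w \<noteq> x" using F[of e] by (auto simp: card_2_iff)
    have "w \<in> set q"
    proof (rule ccontr)
      assume "w \<notin> set q"
      then have "?path (w # q)" using q w e x by (auto simp: successively_Cons insert_commute)
      then show False using max by fastforce
    qed
    then show "e \<in> (\<lambda>j. {x, q ! j}) ` I" using e w by (auto simp: I_def in_set_conv_nth)
  qed
  then have "card {e\<in>F. x \<in> e} \<le> card I" using finI by (rule surj_card_le[rotated])
  then have cI: "d \<le> card I" using deg[OF x(2)] by simp
  have cycle: "is_cycle U F (x # drop i (take (Suc j) q))" if ij: "i < j" "i \<in> I" "j \<in> I" for i j
  proof (rule is_cycleI)
    let ?t = "drop i (take (Suc j) q)"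
    have j: "j < length q" "0 < i" using ij I0 by (auto simp: I_def)
    have ne: "?t \<noteq> []" using ij j by simp
    have l: "last ?t = q ! j" using ij j by (simp add: last_drop last_conv_nth)
    have h: "hd ?t = q ! i" using ij j by (simp add: hd_drop_conv_nth)
    have "x \<notin> set ?t"
    proof
      assume "x \<in> set ?t"
      then obtain l where "l < length ?t" "?t ! l = q ! 0" by (auto simp: x_def in_set_conv_nth)
      then have "i + l < length q" "q ! (i + l) = q ! 0" using ij j by auto
      then show False using q j(2) by (metis add_is_0 length_greater_0_conv less_numeral_extra(3) nth_eq_iff_index_eq)
    qed
    then show "distinct (x # ?t)" using q by simp
    show "3 \<le> length (x # ?t)" using ij j by simp
    show "set (x # ?t) \<subseteq> U" using q x by (auto dest: in_set_dropD in_set_takeD)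
    have "q = take i q @ ?t @ drop (Suc j) q"
      using ij by (metis append.assoc append_take_drop_id less_SucI less_imp_le min.absorb1 take_take)
    then have "successively (\<lambda>x y. {x, y} \<in> F) ?t" using q by (metis successively_append_iff)
    then show "successively (\<lambda>x y. {x, y} \<in> F) (x # ?t)"
      using ij h by (auto simp: successively_Cons I_def)
    show "{last (x # ?t), hd (x # ?t)} \<in> F" using ij l ne by (auto simp: I_def insert_commute)
  qed
  \<comment> \<open>The cycle through \<open>x\<close> and the segment from position
    \<open>i\<close> to position \<open>j\<close> has \<open>j - i + 2\<close> vertices.\<close>
  have gap: "i + (g - 2) \<le> j" if "i < j" "i \<in> I" "j \<in> I" for i j
    using g(1)[OF cycle[OF that]] that by (auto simp: I_def)
  define M where "M = Max I"
  have "I \<noteq> {}" using cI d by auto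
  then have M: "M \<in> I" and Mge: "\<And>j. j \<in> I \<Longrightarrow> j \<le> M" using finI by (auto simp: M_def)
  \<comment> \<open>Cut the positions from 1 on into blocks of length \<open>g - 2\<close>. Each
    block holds at most one neighbour of \<open>x\<close>, so \<open>card I\<close> neighbours push
    the last one, \<open>M\<close>, into block number \<open>card I - 1\<close> or later.\<close>
  have "inj_on (\<lambda>j. (j - 1) div (g - 2)) I"
  proof (rule linorder_inj_onI)
    fix i j assume "i < j" "i \<in> I" "j \<in> I"
    then have "(i - 1) + (g - 2) \<le> j - 1" using gap I0[of i] by fastforce
    then have "((i - 1) + (g - 2)) div (g - 2) \<le> (j - 1) div (g - 2)" by (rule div_le_mono)
    moreover have "((i - 1) + (g - 2)) div (g - 2) = Suc ((i - 1) div (g - 2))"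
      using g(2) by (intro div_add_self2[THEN trans]) auto
    ultimately show "(i - 1) div (g - 2) \<noteq> (j - 1) div (g - 2)" by linarith
  qed (rule linear)
  moreover have "(\<lambda>j. (j - 1) div (g - 2)) ` I \<subseteq> {..(M - 1) div (g - 2)}"
    using Mge by (auto intro!: div_le_mono diff_le_mono)
  ultimately have "card I \<le> card {..(M - 1) div (g - 2)}" by (rule card_inj_on_le) simp
  then have "d - 1 \<le> (M - 1) div (g - 2)" using cI by simp
  then have "(d - 1) * (g - 2) \<le> (M - 1) div (g - 2) * (g - 2)" by (rule mult_le_mono1)
  also have "\<dots> \<le> M - 1" by simp
  finally have len: "(d - 1) * (g - 2) + 2 \<le> Suc M" using I0[OF M] by simp
  let ?p = "take (Suc M) q"
  have M_less: "M < length q" using M by (simp add: I_def)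
  have "0 < (d - 1) * (g - 2)" using d g(2) by simp
  then have "3 \<le> Suc M" using len by linarith
  have "is_cycle U F ?p"
  proof (rule is_cycleI)
    show "successively (\<lambda>x y. {x, y} \<in> F) ?p" using q by (metis append_take_drop_id successively_append_iff)
    show "{last ?p, hd ?p} \<in> F"
    proof -
      have "last ?p = q ! M" using M_less by (simp add: take_Suc_conv_app_nth)
      moreover have "hd ?p = x" using x by simp
      ultimately show ?thesis using M by (simp add: I_def insert_commute)
    qed
  qed (use q M_less \<open>3 \<le> Suc M\<close> in \<open>auto dest: in_set_takeD\<close>)
  moreover have "\<exists>r\<ge>2. r + 2 \<le> length ?p \<and> {?p ! 0, ?p ! r} \<in> F" if "d \<ge> 3"
  proof -
    \<comment> \<open>Positions 1 and \<open>M\<close> hold the neighbours of \<open>x\<close> along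
      the cycle; a third neighbour is the far end of a chord.\<close>
    have "\<not> I \<subseteq> {1, M}"
      using that cI card_mono[of "{1, M}" I] card_insert_le_m1[of 2 "{M}" 1] by auto
    then obtain r where r: "r \<in> I" "r \<noteq> 1" "r \<noteq> M" by blast
    then have "2 \<le> r" "r < M" using I0[of r] Mge[of r] by auto
    then show ?thesis using r M_less by (intro exI[of _ r]) (auto simp: I_def x_def)
  qed
  ultimately show ?thesis using len M_less by (intro exI[of _ ?p]) auto
qed

subsection \<open>Breadth-first layers\<close>

text \<open>In relation form, \<open>adj E ^^ i\<close> relates the ends of walks of length
  \<open>i\<close>.\<close>

definition adj :: "'a set set \<Rightarrow> ('a \<times> 'a) set" where
  "adj E = {(x, y). {x, y} \<in> E}"

text \<open>The sphere of radius \<open>i\<close> about \<open>r\<close> in the graph distance,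
  since a shortest walk is a path.\<close>

definition layer :: "'a set set \<Rightarrow> 'a \<Rightarrow> nat \<Rightarrow> 'a set" where
  "layer E r i = {v. (r, v) \<in> adj E ^^ i \<and> (\<forall>j<i. (r, v) \<notin> adj E ^^ j)}"

definition edges_between :: "'a set set \<Rightarrow> 'a set \<Rightarrow> 'a set \<Rightarrow> 'a set set" where
  "edges_between E S T = {e\<in>E. \<exists>x\<in>S. \<exists>y\<in>T. e = {x, y}}"

lemma layer_0: "layer E r 0 = {r}"
  by (auto simp: layer_def)

lemma layer_disjoint: "v \<in> layer E r i \<Longrightarrow> v \<in> layer E r j \<Longrightarrow> i = j"
  unfolding layer_def by (metis (mono_tags, lifting) mem_Collect_eq nat_neq_iff)

lemma layer_exists:
  assumes "(r, v) \<in> adj E ^^ i"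
  shows "\<exists>j\<le>i. v \<in> layer E r j"
proof -
  define j where "j = (LEAST j. (r, v) \<in> adj E ^^ j)"
  have "(r, v) \<in> adj E ^^ j" using assms unfolding j_def by (rule LeastI)
  moreover have "\<forall>l<j. (r, v) \<notin> adj E ^^ l" unfolding j_def by (auto dest: not_less_Least)
  moreover have "j \<le> i" using assms unfolding j_def by (rule Least_le)
  ultimately show ?thesis by (auto simp: layer_def)
qed

lemma layer_parent:
  assumes "v \<in> layer E r (Suc i)"
  shows "\<exists>u\<in>layer E r i. {u, v} \<in> E"
proof -
  obtain u where u: "(r, u) \<in> adj E ^^ i" "(u, v) \<in> adj E" using assms by (auto simp: layer_def)
  have "(r, u) \<notin> adj E ^^ j" if "j < i" for j
  proof
    assume "(r, u) \<in> adj E ^^ j"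
    then have "(r, v) \<in> adj E ^^ Suc j" using u(2) by (rule relpow_Suc_I)
    then show False using assms that by (auto simp: layer_def simp del: relpow.simps)
  qed
  then show ?thesis using u by (auto simp: layer_def adj_def)
qed

lemma layer_subset:
  assumes "fin_simple_graph V E" "r \<in> V"
  shows "layer E r i \<subseteq> V"
proof
  fix v assume "v \<in> layer E r i"
  then show "v \<in> V"
    using assms layer_parent[of v E r] by (cases i) (fastforce simp: layer_0 fin_simple_graph_def)+
qed

lemma layer_parity:
  assumes sides: "\<And>x y. {x, y} \<in> E \<Longrightarrow> x \<in> A \<longleftrightarrow> y \<notin> A"
  shows "v \<in> layer E r i \<Longrightarrow> v \<in> A \<longleftrightarrow> (r \<in> A \<longleftrightarrow> even i)"
proof (induction i arbitrary: v)
  case 0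
  then show ?case by (simp add: layer_0)
next
  case (Suc i)
  obtain u where u: "u \<in> layer E r i" "{u, v} \<in> E" using layer_parent[OF Suc.prems] by blast
  then show ?case using Suc.IH[OF u(1)] sides[OF u(2)] by auto
qed

text \<open>Distances of adjacent vertices from \<open>r\<close> differ by at most one, and in a
  bipartite graph parity rules out equality.\<close>

lemma layer_neighbour:
  assumes sides: "\<And>x y. {x, y} \<in> E \<Longrightarrow> x \<in> A \<longleftrightarrow> y \<notin> A"
    and u: "u \<in> layer E r i" and e: "{u, v} \<in> E"
  shows "v \<in> layer E r (Suc i) \<or> (\<exists>j. i = Suc j \<and> v \<in> layer E r j)"
proof -
  have "(r, v) \<in> adj E ^^ Suc i" using u e by (auto simp: layer_def adj_def)
  from layer_exists[OF this] obtain j where j: "j \<le> Suc i" "v \<in> layer E r j" by blast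
  have "(r, u) \<in> adj E ^^ Suc j" using j e by (auto simp: layer_def adj_def insert_commute)
  from layer_exists[OF this] obtain l where l: "l \<le> Suc j" "u \<in> layer E r l" by blast
  then have "i \<le> Suc j" using layer_disjoint[OF u l(2)] by simp
  moreover have "even i \<longleftrightarrow> odd j"
    using layer_parity[of E A, OF sides u] layer_parity[of E A, OF sides j(2)] sides[OF e] by blast
  ultimately have "j = Suc i \<or> i = Suc j" using j(1) by presburger
  then show ?thesis using j by auto
qed

text \<open>Otherwise consecutive layers span few edges. The edges at a layer all lead to its two
  neighbouring layers, so by the degree bound the next layer is larger by the factor
  \<open>x\<close>; after \<open>k\<close> steps there are too many vertices.\<close>

lemma layer_growth:
  fixes x L :: real
  assumes G: "fin_simple_graph V E" and sides: "\<And>x y. {x, y} \<in> E \<Longrightarrow> x \<in> A \<longleftrightarrow> y \<notin> A"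
    and r: "r \<in> V" and k: "k \<ge> 1" and x: "x \<ge> 1" "x ^ k \<ge> card V" and L: "L \<ge> 1"
    and deg: "\<And>v. v \<in> V \<Longrightarrow> 4 * L * x \<le> card {e\<in>E. v \<in> e}"
  shows "\<exists>i<k. layer E r i \<noteq> {} \<and>
    L * (card (layer E r i) + card (layer E r (Suc i)))
      \<le> card (edges_between E (layer E r i) (layer E r (Suc i)))"
proof (rule ccontr)
  let ?S = "layer E r" and ?B = "\<lambda>i. edges_between E (layer E r i) (layer E r (Suc i))"
  assume no: "\<not> ?thesis"
  then have few: "card (?B i) < L * (card (?S i) + card (?S (Suc i)))" if "i < k" "?S i \<noteq> {}" for i
    using that by (meson not_le)
  have finV: "finite V" and "E \<subseteq> Pow V" using G by (auto simp: fin_simple_graph_def)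
  then have finE: "finite E" by (simp add: finite_subset)
  have SV: "?S i \<subseteq> V" for i by (rule layer_subset[OF G r])
  then have finS: "finite (?S i)" for i using finV finite_subset by blast
  have degsum: "4 * L * x * card (?S i) \<le> card {e\<in>E. \<exists>v\<in>?S i. v \<in> e}" for i
  proof -
    \<comment> \<open>All vertices of a layer lie on one side, so summing degrees counts no edge
      twice.\<close>
    have disj: "{e\<in>E. u \<in> e} \<inter> {e\<in>E. v \<in> e} = {}" if "u \<in> ?S i" "v \<in> ?S i" "u \<noteq> v" for u v
    proof -
      have "e = {u, v}" if "e \<in> E" "u \<in> e" "v \<in> e" for e
        using G that \<open>u \<noteq> v\<close> by (auto simp: fin_simple_graph_def card_2_iff)
      moreover have "u \<in> A \<longleftrightarrow> v \<in> A"
        using layer_parity[of E A, OF sides] that by metis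
      ultimately show ?thesis using sides by blast
    qed
    have "4 * L * x * card (?S i) = (\<Sum>v\<in>?S i. 4 * L * x)" by simp
    also have "\<dots> \<le> (\<Sum>v\<in>?S i. real (card {e\<in>E. v \<in> e}))"
      using SV deg by (intro sum_mono) auto
    also have "\<dots> = real (card (\<Union>v\<in>?S i. {e\<in>E. v \<in> e}))"
      using finE finS disj by (subst card_UN_disjoint) auto
    also have "(\<Union>v\<in>?S i. {e\<in>E. v \<in> e}) = {e\<in>E. \<exists>v\<in>?S i. v \<in> e}" by auto
    finally show ?thesis .
  qed
  have inc: "e \<in> ?B i \<or> (\<exists>j. i = Suc j \<and> e \<in> ?B j)" if e: "e \<in> E" "v \<in> ?S i" "v \<in> e" for e v i
  proof -
    have "card e = 2" using G e by (simp add: fin_simple_graph_def)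
    then obtain w where w: "e = {v, w}" using e(3) by (auto simp: card_2_iff)
    then show ?thesis using layer_neighbour[of E A v r i w, OF sides] e
      by (fastforce simp: edges_between_def insert_commute)
  qed
  have finB: "finite (?B i)" for i using finE by (simp add: edges_between_def)
  have "?S i \<noteq> {} \<and> card (?S i) \<ge> x ^ i \<and>
      (i < k \<longrightarrow> x * card (?S i) \<le> card (?S (Suc i)))" if "i \<le> k" for i
    using that
  proof (induction i)
    case 0
    have "{e\<in>E. \<exists>v\<in>?S 0. v \<in> e} \<subseteq> ?B 0" using inc by blast
    then have "card {e\<in>E. \<exists>v\<in>?S 0. v \<in> e} \<le> card (?B 0)" using finB by (rule card_mono[rotated])
    then have "4 * L * x < L * (1 + card (?S (Suc 0)))"
      using degsum[of 0] few[of 0] k by (simp add: layer_0)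
    then have "L * (4 * x) < L * (1 + card (?S (Suc 0)))" by (simp add: mult.assoc mult.left_commute)
    then have "4 * x < 1 + card (?S (Suc 0))" using L by (simp only: mult_less_cancel_left_pos)
    then show ?case using x by (simp add: layer_0)
  next
    case (Suc i)
    then have IH: "?S i \<noteq> {}" "card (?S i) \<ge> x ^ i" "x * card (?S i) \<le> card (?S (Suc i))" by auto
    have "x * x ^ i \<le> x * card (?S i)" using IH(2) x by (intro mult_left_mono) auto
    then have pow: "x ^ Suc i \<le> card (?S (Suc i))" using IH(3) by simp
    have "0 < x ^ Suc i" using x by simp
    then have ne: "?S (Suc i) \<noteq> {}" using pow by auto
    have "x * card (?S (Suc i)) \<le> card (?S (Suc (Suc i)))" if "Suc i < k"
    proof -
      have "{e\<in>E. \<exists>v\<in>?S (Suc i). v \<in> e} \<subseteq> ?B i \<union> ?B (Suc i)" using inc by blast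
      then have "card {e\<in>E. \<exists>v\<in>?S (Suc i). v \<in> e} \<le> card (?B i \<union> ?B (Suc i))"
        using finB by (intro card_mono) auto
      also have "\<dots> \<le> card (?B i) + card (?B (Suc i))" by (rule card_Un_le)
      finally have "4 * L * x * card (?S (Suc i)) \<le> card (?B i) + card (?B (Suc i))"
        using degsum[of "Suc i"] by linarith
      also have "\<dots> \<le> L * (card (?S i) + card (?S (Suc i)))
          + L * (card (?S (Suc i)) + card (?S (Suc (Suc i))))"
        using few[of i] few[of "Suc i"] that IH(1) ne by simp
      finally have "L * (4 * (x * card (?S (Suc i))))
          \<le> L * (card (?S i) + 2 * real (card (?S (Suc i))) + card (?S (Suc (Suc i))))"
        by (simp add: algebra_simps)
      then have 1: "4 * (x * card (?S (Suc i)))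
          \<le> card (?S i) + 2 * real (card (?S (Suc i))) + card (?S (Suc (Suc i)))"
        using L by (simp only: mult_le_cancel_left_pos)
      \<comment> \<open>The first two terms on the right amount to at most three times
        \<open>x * card (?S (Suc i))\<close>; the constant 4 leaves one such multiple for the next
        layer.\<close>
      have "1 * real (card (?S i)) \<le> x * card (?S i)" using x by (intro mult_right_mono) auto
      then have 2: "real (card (?S i)) \<le> card (?S (Suc i))" using IH(3) by simp
      have 3: "1 * real (card (?S (Suc i))) \<le> x * card (?S (Suc i))"
        using x by (intro mult_right_mono) auto
      show ?thesis using 1 2 3 by linarith
    qed
    then show ?case using pow ne by blast
  qed
  \<comment> \<open>Layer \<open>k\<close> would fill the whole vertex set, but the root is not in
    it.\<close>
  from this[of k] have "real (card (?S k)) \<ge> card V" using x by simp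
  moreover have "r \<notin> ?S k" using layer_disjoint[of r E r 0 k] k by (auto simp: layer_0)
  then have "?S k \<subset> V" using SV[of k] r by blast
  then have "card (?S k) < card V" using finV by (rule psubset_card_mono[rotated])
  ultimately show False by simp
qed

section \<open>Climbing the breadth-first tree\<close>

lemma climb_layer:
  assumes par: "\<And>j v. v \<in> layer E r (Suc j) \<Longrightarrow> par v \<in> layer E r j"
    and "v \<in> layer E r i" "j \<le> i"
  shows "(par ^^ j) v \<in> layer E r (i - j)"
  using assms(3)
proof (induction j)
  case (Suc j)
  then have "(par ^^ j) v \<in> layer E r (Suc (i - Suc j))" by (simp add: Suc_diff_Suc)
  then show ?case using par by simp
qed (use assms in simp)

text \<open>At height \<open>i\<close> all tree paths have reached the root, so there is a least
  height \<open>h\<close> at which they have merged. The ancestors at height \<open>h - 1\<close>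
  then split \<open>Z\<close> into at least two classes.\<close>

lemma branching_level:
  assumes par: "\<And>j v. v \<in> layer E r (Suc j) \<Longrightarrow> par v \<in> layer E r j"
    and Z: "Z \<subseteq> layer E r i" "a \<in> Z" "b \<in> Z" "a \<noteq> b"
  shows "\<exists>h. 1 \<le> h \<and> h \<le> i \<and> (\<forall>u\<in>Z. \<forall>v\<in>Z. (par ^^ h) u = (par ^^ h) v)
    \<and> (\<exists>u\<in>Z. \<exists>v\<in>Z. (par ^^ (h - 1)) u \<noteq> (par ^^ (h - 1)) v)"
proof -
  let ?const = "\<lambda>h. \<forall>u\<in>Z. \<forall>v\<in>Z. (par ^^ h) u = (par ^^ h) v"
  define h where "h = (LEAST h. ?const h)"
  have "(par ^^ i) u = r" if "u \<in> Z" for u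
    using climb_layer[of E r par u i i] par Z that by (auto simp: layer_0)
  then have ci: "?const i" by simp
  then have hi: "h \<le> i" and ch: "?const h"
    unfolding h_def by (rule Least_le, rule LeastI[of ?const])
  have h0: "h \<noteq> 0"
  proof
    assume "h = 0"
    then have "?const 0" using ch by simp
    then show False using Z by simp
  qed
  then have "\<not> ?const (h - 1)"
    using not_less_Least[of "h - 1" ?const] by (simp add: h_def)
  moreover have "1 \<le> h" using h0 by simp
  ultimately show ?thesis using hi ch by blast
qed

text \<open>The tree paths from the two ends of \<open>q\<close> meet first at height
  \<open>h\<close> and otherwise run through layers below \<open>i\<close>, away from
  \<open>q\<close>; together with \<open>q\<close> they form a cycle.\<close>

lemma close_path_in_tree:
  assumes G: "fin_simple_graph V E" and r: "r \<in> V"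
    and par: "\<And>j v. v \<in> layer E r (Suc j) \<Longrightarrow> par v \<in> layer E r j \<and> {par v, v} \<in> E"
    and q: "distinct q" "successively (\<lambda>x y. {x, y} \<in> E) q" "q \<noteq> []"
      "set q \<subseteq> layer E r i \<union> layer E r (Suc i)"
    and ends: "hd q \<in> layer E r i" "last q \<in> layer E r i"
    and h: "1 \<le> h" "h \<le> i" "(par ^^ h) (hd q) = (par ^^ h) (last q)"
      "(par ^^ (h - 1)) (hd q) \<noteq> (par ^^ (h - 1)) (last q)"
  shows "\<exists>p. is_cycle V E p \<and> length p = length q + 2 * h - 1"
proof -
  let ?S = "layer E r"
  define a b where "a = hd q" and "b = last q"
  define f where "f v j = (par ^^ j) v" for v j
  have ab: "a \<in> ?S i" "b \<in> ?S i" using ends by (auto simp: a_def b_def)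
  have par1: "par v \<in> ?S j" if "v \<in> ?S (Suc j)" for j v using par that by blast
  have lev: "f v j \<in> ?S (i - j)" if "v \<in> ?S i" "j \<le> i" for v j
    unfolding f_def by (rule climb_layer) (use par1 that in auto)
  have edge: "{f v j, f v (Suc j)} \<in> E" if "v \<in> ?S i" "j < i" for v j
  proof -
    have "f v j \<in> ?S (Suc (i - Suc j))" using lev[of v j] that by (simp add: Suc_diff_Suc)
    then show ?thesis using par[of "f v j" "i - Suc j"] by (simp add: f_def insert_commute)
  qed
  \<comment> \<open>Tree paths that have merged stay merged, so distinctness at height
    \<open>h - 1\<close> passes to all smaller heights.\<close>
  have neq: "f a j \<noteq> f b j" if "j < h" for j
  proof
    assume eq: "f a j = f b j"
    have "h - 1 = (h - 1 - j) + j" using that by simp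
    then have "f v (h - 1) = (par ^^ (h - 1 - j)) (f v j)" for v
      unfolding f_def by (metis comp_apply funpow_add)
    then show False using h(4) eq by (simp add: f_def a_def b_def)
  qed
  have top: "f a h = f b h" using h by (simp add: f_def a_def b_def)
  have same_lev: "j = l" if "f u j = f v l" "u \<in> ?S i" "v \<in> ?S i" "j \<le> i" "l \<le> i" for u v j l
  proof -
    have "i - j = i - l" using that lev layer_disjoint by metis
    then show ?thesis using that by simp
  qed
  have notq: "f v j \<notin> set q" if "v \<in> ?S i" "1 \<le> j" "j \<le> i" for v j
  proof
    assume "f v j \<in> set q"
    then have "f v j \<in> ?S i \<or> f v j \<in> ?S (Suc i)" using q by auto
    then have "i - j = i \<or> i - j = Suc i" using lev[of v j] that layer_disjoint by metis
    then show False using that by auto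
  qed
  \<comment> \<open>\<open>?B\<close> leads from the end of \<open>q\<close> to the meeting vertex
    and includes it; \<open>?A\<close> leads back to the start of \<open>q\<close> and is empty when
    \<open>h = 1\<close>.\<close>
  let ?B = "map (f b) [1..<Suc h]" and ?A = "map (f a) (rev [1..<h])"
  let ?p = "q @ ?B @ ?A"
  have inj: "inj_on (f v) {..i}" if "v \<in> ?S i" for v
    using same_lev that by (auto intro: inj_onI)
  have up: "successively (\<lambda>x y. {x, y} \<in> E) (map (f v) [l..<m])" if "v \<in> ?S i" "m \<le> Suc i" for v l m
    using edge that by (auto simp: successively_conv_nth nth_upt)
  have down: "successively (\<lambda>x y. {x, y} \<in> E) ?A"
    using up[of a h 1] ab h by (simp add: rev_map[symmetric] successively_rev insert_commute)
  have hdB: "hd ?B = f b 1" "last ?B = f b h" "?B \<noteq> []"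
    using h by (auto simp: hd_append upt_conv_Cons le_Suc_eq)
  have hdA: "hd ?A = f a (h - 1)" "last ?A = f a 1" if "h > 1"
    using that by (auto simp: rev_map[symmetric] hd_rev last_rev last_map hd_map)
  have "is_cycle V E ?p"
  proof (rule is_cycleI)
    have "inj_on (f b) (set [1..<Suc h])"
      by (rule inj_on_subset[OF inj[OF ab(2)]]) (use h in auto)
    moreover have "inj_on (f a) (set [1..<h])"
      by (rule inj_on_subset[OF inj[OF ab(1)]]) (use h in auto)
    moreover have "f b j \<noteq> f a l" if "1 \<le> j" "j \<le> h" "1 \<le> l" "l < h" for j l
      using same_lev[of b j a l] neq[of l] that ab h by auto
    ultimately show "distinct ?p"
      using q notq ab h by (auto simp: distinct_map simp del: upt_Suc)
    have "a \<noteq> b" using neq[of 0] h by (simp add: f_def)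
    then have "length q \<noteq> 1" by (auto simp: a_def b_def length_Suc_conv)
    then have "length q \<ge> 2" using q(3) by (cases q) (auto simp: Suc_le_eq)
    then show "3 \<le> length ?p" using h by simp
    have SV: "?S j \<subseteq> V" for j by (rule layer_subset[OF G r])
    have "f v j \<in> V" if "v \<in> ?S i" "j \<le> i" for v j using lev[OF that] SV by blast
    moreover have "set q \<subseteq> V" using q(4) SV by blast
    ultimately show "set ?p \<subseteq> V" using ab h(2) by (auto simp del: upt_Suc)
    have "{b, f b 1} \<in> E" using edge[OF ab(2), of 0] h by (simp add: f_def)
    moreover have "{f b h, f a (h - 1)} \<in> E" if "h > 1"
      using edge[OF ab(1), of "h - 1"] h top that by (simp add: insert_commute)
    ultimately show "successively (\<lambda>x y. {x, y} \<in> E) ?p"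
      using q(2) up[of b "Suc h" 1] down ab h hdA hdB
      by (cases "h > 1") (auto simp: successively_append_iff b_def simp del: upt_Suc)
    have "{a, f a 1} \<in> E" using edge[OF ab(1), of 0] h by (simp add: f_def)
    moreover have "last ?p = f a 1"
    proof (cases "h > 1")
      case True
      then show ?thesis using hdA by simp
    next
      case False
      then have "h = 1" using h by simp
      then show ?thesis using top by simp
    qed
    ultimately show "{last ?p, hd ?p} \<in> E" using q(3) by (simp add: a_def insert_commute)
  qed
  moreover have "length ?p = length q + 2 * h - 1" using h by simp
  ultimately show ?thesis by blast
qed

subsection \<open>Cycles of length \<open>2 * k\<close>\<close>

lemma girth_le: "is_cycle V E p \<Longrightarrow> girth V E \<le> enat (length p)"
  unfolding girth_def by (rule INF_lower) simp

lemma girth_attained: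
  assumes "girth V E = enat g"
  shows "\<exists>p. is_cycle V E p \<and> length p = g"
proof -
  let ?A = "(\<lambda>p. enat (length p)) ` {p. is_cycle V E p}"
  have "?A \<noteq> {}"
  proof
    assume "?A = {}"
    then have "girth V E = \<infinity>" by (simp add: girth_def Inf_enat_def)
    then show False using assms by simp
  qed
  then have "girth V E \<in> ?A"
    unfolding girth_def Inf_enat_def by (auto intro: LeastI)
  then show ?thesis using assms by auto
qed

text \<open>For \<open>L = 1\<close> the cycle between the layers need not have a chord, so only
  paths of length 2 are used and the length is merely bounded.\<close>

lemma even_cycle_from_layers:
  fixes L k g :: nat and x :: real
  assumes G: "fin_simple_graph V E" and sides: "\<And>x y. {x, y} \<in> E \<Longrightarrow> x \<in> A \<longleftrightarrow> y \<notin> A"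
    and "V \<noteq> {}" and k: "k \<ge> 2" and x: "x \<ge> 1" "x ^ k \<ge> card V" and L: "L \<ge> 1"
    and g: "\<And>p. is_cycle V E p \<Longrightarrow> g \<le> length p" "g \<ge> 3"
    and dense: "card E \<ge> 4 * real L * x * card V"
    and long: "L = 1 \<or> L * (g - 2) \<ge> 2 * (k - 1)"
  shows "\<exists>p. is_cycle V E p \<and> (if L = 1 then length p \<le> 2 * k else length p = 2 * k)"
proof -
  obtain W where W: "W \<subseteq> V" "W \<noteq> {}"
    and degW: "\<And>v. v \<in> W \<Longrightarrow> 4 * real L * x < card {e\<in>E. e \<subseteq> W \<and> v \<in> e}"
    using dense_subgraph[OF G \<open>V \<noteq> {}\<close> _ dense] x L by auto
  define E' where "E' = {e\<in>E. e \<subseteq> W}"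
  have finV: "finite V" using G by (simp add: fin_simple_graph_def)
  have G': "fin_simple_graph W E'"
    using G finite_subset[OF W(1)] by (auto simp: fin_simple_graph_def E'_def)
  have sides': "\<And>x y. {x, y} \<in> E' \<Longrightarrow> x \<in> A \<longleftrightarrow> y \<notin> A" using sides by (simp add: E'_def)
  have deg': "4 * real L * x \<le> card {e\<in>E'. v \<in> e}" if "v \<in> W" for v
    using degW[OF that] by (simp add: E'_def conj_ac)
  have "card W \<le> card V" using finV W by (intro card_mono) auto
  then have xW: "x ^ k \<ge> card W" using x by linarith
  obtain r where r: "r \<in> W" using W by blast
  let ?S = "layer E' r"
  obtain i where i: "i < k" "?S i \<noteq> {}"
    and many: "real L * (card (?S i) + card (?S (Suc i)))
      \<le> card (edges_between E' (?S i) (?S (Suc i)))"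
    using layer_growth[of W E' A r k x "real L"] G' sides' r k x xW L deg' by auto
  define F0 where "F0 = edges_between E' (?S i) (?S (Suc i))"
  define U0 where "U0 = ?S i \<union> ?S (Suc i)"
  have disj: "?S i \<inter> ?S (Suc i) = {}" using layer_disjoint[of _ E' r i "Suc i"] by auto
  have U0W: "U0 \<subseteq> W" using layer_subset[OF G' r] by (simp add: U0_def)
  then have finU0: "finite U0" using W(1) by (intro finite_subset[OF _ finV]) auto
  have G0: "fin_simple_graph U0 F0"
    using G' finU0 by (auto simp: fin_simple_graph_def F0_def edges_between_def U0_def)
  have "card U0 = card (?S i) + card (?S (Suc i))"
    using disj finU0 by (simp add: U0_def card_Un_disjoint)
  then have "real L * card U0 \<le> card F0" using many by (simp add: F0_def)
  then obtain U where U: "U \<subseteq> U0" "U \<noteq> {}"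
    and degU: "\<And>v. v \<in> U \<Longrightarrow> real L < card {e\<in>F0. e \<subseteq> U \<and> v \<in> e}"
    using dense_subgraph[OF G0, of "real L"] i L by (auto simp: U0_def)
  define F where "F = {e\<in>F0. e \<subseteq> U}"
  have GF: "fin_simple_graph U F"
    using G0 finite_subset[OF U(1)] by (auto simp: fin_simple_graph_def F_def)
  \<comment> \<open>The strict bound gains one for integer degrees, which is what yields the full
    factor \<open>L\<close> in the length of the cycle.\<close>
  have degF: "L + 1 \<le> card {e\<in>F. v \<in> e}" if "v \<in> U" for v
    using degU[OF that] by (simp add: F_def conj_ac)
  have FE': "F \<subseteq> E'" by (auto simp: F_def F0_def edges_between_def)
  have FE: "F \<subseteq> E" using FE' by (auto simp: E'_def)
  have UV: "U \<subseteq> V" using U U0W W by blast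
  have gF: "g \<le> length p" if "is_cycle U F p" for p
    using g(1)[OF is_cycle_mono[OF that UV FE]] .
  then obtain p where p: "is_cycle U F p" "L * (g - 2) + 2 \<le> length p"
    and chord: "L \<ge> 2 \<Longrightarrow> \<exists>r\<ge>2. r + 2 \<le> length p \<and> {p ! 0, p ! r} \<in> F"
    using long_cycle_chord[OF GF U(2) degF _ gF g(2)] L by auto
  have sidesF: "y \<in> ?S i \<longleftrightarrow> z \<notin> ?S i" if "{y, z} \<in> F" for y z
    using that disj by (auto simp: F_def F0_def edges_between_def doubleton_eq_iff)
  \<comment> \<open>A vertex lies in at most one layer, so one parent function serves all
    layers.\<close>
  have "\<exists>u. \<forall>j. v \<in> ?S (Suc j) \<longrightarrow> u \<in> ?S j \<and> {u, v} \<in> E'" for v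
  proof (cases "\<exists>j. v \<in> ?S (Suc j)")
    case True
    then obtain j where j: "v \<in> ?S (Suc j)" by blast
    then have "l = j" if "v \<in> ?S (Suc l)" for l using layer_disjoint[OF that j] by simp
    then show ?thesis using layer_parent[OF j] by blast
  qed blast
  then obtain par where par: "\<And>j v. v \<in> ?S (Suc j) \<Longrightarrow> par v \<in> ?S j \<and> {par v, v} \<in> E'"
    by metis
  define Z where "Z = set p \<inter> ?S i"
  obtain a0 b0 where "a0 \<in> Z" "b0 \<in> Z" "a0 \<noteq> b0"
    using cycle_two_on_side[OF p(1), of "?S i"] sidesF by (auto simp: Z_def)
  then obtain h a b where h: "1 \<le> h" "h \<le> i" "\<And>u v. u \<in> Z \<Longrightarrow> v \<in> Z \<Longrightarrow> (par ^^ h) u = (par ^^ h) v"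
    and ab: "a \<in> Z" "b \<in> Z" "(par ^^ (h - 1)) a \<noteq> (par ^^ (h - 1)) b"
    using branching_level[of E' r par Z i a0 b0] par unfolding Z_def by blast
  \<comment> \<open>The colour of a vertex is its ancestor at height \<open>h - 1\<close>. A path of
    length \<open>2 * m\<close> with ends of different colours has ends whose tree paths meet
    exactly at height \<open>h\<close>.\<close>
  have close: "\<exists>p. is_cycle V E p \<and> length p = 2 * m + 2 * h"
    if m: "0 < m" "2 * m < length p" "m = 1 \<or> L \<ge> 2" for m
  proof -
    obtain q where q: "distinct q" "successively (\<lambda>x y. {x, y} \<in> F) q" "set q \<subseteq> set p"
      "length q = 2 * m + 1" "hd q \<in> ?S i" "last q \<in> ?S i"
      "(par ^^ (h - 1)) (hd q) \<noteq> (par ^^ (h - 1)) (last q)"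
      using cycle_theta_path[where P = "par ^^ (h - 1)", OF p(1) sidesF m(1,2) _ _ _ _ _ ab(3)]
        m(3) chord ab(1,2)
      unfolding Z_def by blast
    have "q \<noteq> []" using q(4) by auto
    then have "hd q \<in> Z" "last q \<in> Z" using q by (auto simp: Z_def)
    then have "(par ^^ h) (hd q) = (par ^^ h) (last q)" using h by blast
    moreover have "successively (\<lambda>x y. {x, y} \<in> E') q"
      using q(2) FE' by (auto intro: successively_mono)
    moreover have "set q \<subseteq> ?S i \<union> ?S (Suc i)"
      using q(3) p(1) U by (auto simp: is_cycle_def U0_def)
    ultimately obtain p' where "is_cycle W E' p'" "length p' = length q + 2 * h - 1"
      using close_path_in_tree[OF G' r par q(1) _ \<open>q \<noteq> []\<close> _ q(5,6) h(1,2) _ q(7)] by blast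
    then show ?thesis using is_cycle_mono[of W E' p' V E] W q(4) by (auto simp: E'_def)
  qed
  show ?thesis
  proof (cases "L = 1")
    case True
    have "3 \<le> length p" using p(1) by (simp add: is_cycle_def)
    \<comment> \<open>With \<open>m = 1\<close> the length is \<open>2 + 2 * h\<close>, at most
      \<open>2 * k\<close> because \<open>h \<le> i < k\<close>.\<close>
    then have "2 * 1 < length p" by simp
    from close[OF _ this] show ?thesis using h i True by fastforce
  next
    case False
    then have "2 * (k - 1) \<le> L * (g - 2)" using long by blast
    \<comment> \<open>The choice \<open>m = k - h\<close> makes the length exactly
      \<open>2 * k\<close>; it is positive since \<open>h \<le> i < k\<close>, and
      \<open>h \<ge> 1\<close> makes the path fit into the cycle.\<close>
    then have "2 * (k - h) < length p" using p(2) h by linarith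
    from close[OF _ this] show ?thesis using h i False L by auto
  qed
qed

theorem theorem9:
  fixes V :: "'a set" and E :: "'a set set" and k n g :: nat
  assumes "k \<ge> 2"
    and "fin_simple_graph V E"
    and "bipartite V E"
    and "card V = n"
    and "girth V E = enat g"
    and "real (card E) \<ge>
           4 * of_int \<lceil>2 * (real k - 1) / (real g - 2)\<rceil> * real n powr (1 + 1 / real k)"
  shows "\<exists>p. is_cycle V E p \<and> length p = 2 * k"
proof -
  obtain p0 where p0: "is_cycle V E p0" "length p0 = g" using girth_attained[OF assms(5)] by blast
  have g3: "g \<ge> 3" using p0 by (auto simp: is_cycle_def)
  have gmin: "g \<le> length p" if "is_cycle V E p" for p
    using girth_le[OF that] assms(5) by simp
  have "V \<noteq> {}" using p0 by (auto simp: is_cycle_def)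
  moreover have "finite V" using assms(2) by (simp add: fin_simple_graph_def)
  ultimately have n: "n \<ge> 1" using assms(4) by (metis One_nat_def Suc_leI card_gt_0_iff)
  obtain A B where AB: "A \<inter> B = {}" "\<forall>e\<in>E. \<exists>a\<in>A. \<exists>b\<in>B. e = {a, b}"
    using assms(3) by (auto simp: bipartite_def)
  have sides: "y \<in> A \<longleftrightarrow> z \<notin> A" if "{y, z} \<in> E" for y z
    using AB that by (fastforce simp: doubleton_eq_iff)
  define L where "L = nat \<lceil>2 * (real k - 1) / (real g - 2)\<rceil>"
  have pos: "2 * (real k - 1) / (real g - 2) > 0" using assms(1) g3 by simp
  then have Lpos: "L \<ge> 1" by (simp add: L_def) linarith
  have Lreal: "real L = of_int \<lceil>2 * (real k - 1) / (real g - 2)\<rceil>"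
    using pos by (simp add: L_def)
  have "2 * (real k - 1) / (real g - 2) \<le> real L" unfolding Lreal by (rule le_of_int_ceiling)
  then have "2 * (real k - 1) \<le> real L * (real g - 2)" using g3 by (simp add: pos_divide_le_eq)
  then have "real (2 * (k - 1)) \<le> real (L * (g - 2))" using assms(1) g3 by (simp add: of_nat_diff)
  then have long: "2 * (k - 1) \<le> L * (g - 2)" by (simp only: of_nat_le_iff)
  \<comment> \<open>The growth factor with \<open>x ^ k = n\<close>; the edge bound becomes
    \<open>4 * L * x\<close> edges per vertex.\<close>
  define x where "x = real n powr (1 / real k)"
  have x1: "x \<ge> 1" using n by (simp add: x_def ge_one_powr_ge_zero)
  have xk: "x ^ k = real n"
    using n assms(1) by (simp add: x_def powr_powr flip: powr_realpow)
  have "real n powr (1 + 1 / real k) = x * n" using n by (simp add: powr_add x_def)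
  then have "card E \<ge> 4 * real L * x * card V" using assms(4,6) Lreal by (simp add: mult.assoc)
  then obtain p where p: "is_cycle V E p" "if L = 1 then length p \<le> 2 * k else length p = 2 * k"
    using even_cycle_from_layers[of V E A k x L g] assms(1,2,4) sides \<open>V \<noteq> {}\<close> x1 xk Lpos gmin g3
      long by auto
  show ?thesis
  proof (cases "L = 1")
    case True
    \<comment> \<open>Now \<open>2 * (k - 1) \<le> g - 2\<close>, so no cycle is shorter than
      \<open>2 * k\<close> and the bounded length is exact.\<close>
    then have "g \<ge> 2 * k" using long g3 assms(1) by simp
    then show ?thesis using p gmin True by fastforce
  next
    case False
    then show ?thesis using p by auto
  qed
qed

end
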